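(* Let $\mathbb{E}^n$ be either $\mathbb{R}^n$ or the Heisenberg group $\mathbb{H}_n$, and let $\Omega\subset\mathbb{E}^n$ be open and bounded. Let $\beta\in\{0,1\}$ and let $g:\Omega\to\mathbb{R}$ be $\log^\beta$-Dini continuous in $\Omega$. Then for any $1<q<\infty$ and any $\tau\in(0,1/4)$, $\mathfrak{S}_{[g,q,\tau,\beta]}(x_0,r)$ is finite whenever $r\in(0,1/4)$ and $B_{4r}(x_0)\subset\Omega$. Furthermore, $\mathfrak{S}_{[g,q,\tau,\beta]}(x_0,r)\to0$ as $r\to0$, locally uniformly in $x_0\in\Omega$.
   Context: $\mathbb{R}^n$ carries the Euclidean metric and Lebesgue measure. $\mathbb{H}_n$ is $\mathbb{R}^{2n+1}$ with group law $x\cdot y=\big(x_1+y_1,\dots,x_{2n}+y_{2n},t+s+\frac12\sum_{i=1}^n(x_iy_{n+i}-x_{n+i}y_i)\big)$, with the Korányi metric $d(x,y)=\rho(y^{-1}\cdot x)$, $\rho(x',t)=(|x'|^4+t^2)^{1/4}$, and Lebesgue measure. $d_{\mathbb{E}}$ is the corresponding metric, $B_r(x)$ are metric balls, and $(h)_B=\frac1{|B|}\int_Bh$. Modulus of continuity: $\omega_g(r)=\sup\{|g(x)-g(y)|:x,y\in\Omega,\ d_{\mathbb{E}}(x,y)\le r\}$ for $0<r<\operatorname{diam}\Omega$, $\omega_g(0)=0$. For $\beta\in\{0,1\}$, $g$ is $\log^\beta$-Dini continuous if $g$ is uniformly continuous and $$\int_0^{\frac12\operatorname{diam}\Omega}\omega_g(\rho)\log^\beta\left(\tfrac1\rho\right)\frac{d\rho}\rho<\infty.$$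 With $r_j=\tau^jr$, $$\mathfrak{S}_{[g,q,\tau,\beta]}(x_0,r)=\sum_{j=0}^\infty\log^\beta\left(\tfrac1{r_j}\right)\left(\tfrac1{|B_{r_j}|}\int_{B_{r_j}(x_0)}|g-(g)_{B_{r_j}(x_0)}|^q\right)^{1/q}.$$ *)

theory Defs
  imports "HOL-Analysis.Analysis"
begin

section \<open>The Heisenberg group with the Koranyi metric\<close>

text \<open>
  The coordinates \<open>x\<^sub>1, \<dots>, x\<^sub>2\<^sub>n\<close> are indexed by \<open>'n + 'n\<close> with \<open>n = CARD('n)\<close>:
  \<open>x\<^sub>i\<close> is the component \<open>Inl i\<close> and \<open>x\<^bsub>n+i\<^esub>\<close> is the component \<open>Inr i\<close>.
  A separate type is used so that balls, open sets, diameters and uniform continuity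
  refer to the Koranyi metric and not to the Euclidean metric on the product.
\<close>

typedef ('n::finite) heisenberg = "UNIV :: ((real ^ ('n + 'n)) \<times> real) set"
  morphisms coords Heis by simp

definition horiz :: "'n::finite heisenberg \<Rightarrow> real ^ ('n + 'n)"
  where "horiz x = fst (coords x)"

definition vert :: "'n::finite heisenberg \<Rightarrow> real"
  where "vert x = snd (coords x)"

definition symplectic :: "real ^ ('n::finite + 'n) \<Rightarrow> real ^ ('n + 'n) \<Rightarrow> real"
  where "symplectic x y = (\<Sum>i\<in>UNIV. x $ Inl i * y $ Inr i - x $ Inr i * y $ Inl i)"

lemma horiz_Heis [simp]: "horiz (Heis (z, t)) = z"
  by (simp add: horiz_def Heis_inverse)

lemma vert_Heis [simp]: "vert (Heis (z, t)) = t"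
  by (simp add: vert_def Heis_inverse)

lemma heisenberg_eqI: "horiz x = horiz y \<Longrightarrow> vert x = vert y \<Longrightarrow> x = y"
  by (metis coords_inject horiz_def prod_eqI vert_def)

lemma symplectic_simps:
  "symplectic (x + x') y = symplectic x y + symplectic x' y"
  "symplectic x (y + y') = symplectic x y + symplectic x y'"
  "symplectic (- x) y = - symplectic x y" "symplectic x (- y) = - symplectic x y"
  "symplectic 0 y = 0" "symplectic x 0 = 0" "symplectic x x = 0"
  by (simp_all add: symplectic_def algebra_simps sum.distrib sum_subtractf sum_negf)

text \<open>
  The class \<open>group_add\<close> does not assume commutativity;
  the sum \<open>x + y\<close> is the Heisenberg product \<open>x \<cdot> y\<close> and \<open>- x\<close> is the inverse of \<open>x\<close>.
\<close>

instantiation heisenberg :: (finite) group_add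
begin

definition zero_heisenberg :: "'a heisenberg"
  where "0 = Heis (0, 0)"

definition plus_heisenberg :: "'a heisenberg \<Rightarrow> 'a heisenberg \<Rightarrow> 'a heisenberg"
  where "x + y = Heis (horiz x + horiz y,
                       vert x + vert y + 1 / 2 * symplectic (horiz x) (horiz y))"

definition uminus_heisenberg :: "'a heisenberg \<Rightarrow> 'a heisenberg"
  where "- x = Heis (- horiz x, - vert x)"

definition minus_heisenberg :: "'a heisenberg \<Rightarrow> 'a heisenberg \<Rightarrow> 'a heisenberg"
  where "x - y = x + - (y :: 'a heisenberg)"

instance
  by standard
    (auto intro!: heisenberg_eqI simp: zero_heisenberg_def plus_heisenberg_def
      uminus_heisenberg_def minus_heisenberg_def symplectic_simps algebra_simps)

end

definition koranyi :: "'n::finite heisenberg \<Rightarrow> real"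
  where "koranyi x = root 4 (norm (horiz x) ^ 4 + (vert x)\<^sup>2)"

lemma koranyi_uminus: "koranyi (- x) = koranyi x"
  by (simp add: koranyi_def uminus_heisenberg_def)

lemma koranyi_eq_0_iff: "koranyi x = 0 \<longleftrightarrow> x = 0"
proof -
  have "koranyi x = 0 \<longleftrightarrow> norm (horiz x) ^ 4 + (vert x)\<^sup>2 = 0"
    by (simp add: koranyi_def)
  also have "\<dots> \<longleftrightarrow> horiz x = 0 \<and> vert x = 0"
    by (subst add_nonneg_eq_0_iff) auto
  also have "\<dots> \<longleftrightarrow> x = 0"
    by (auto simp: zero_heisenberg_def intro: heisenberg_eqI)
  finally show ?thesis .
qed

lemma koranyi_cmod: "koranyi x = sqrt (cmod (Complex ((norm (horiz x))\<^sup>2) (vert x)))"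
proof -
  have "root 4 s = sqrt (sqrt s)" for s
    using real_root_mult_exp[of 2 2 s] by (simp add: sqrt_def)
  then show ?thesis
    by (simp add: koranyi_def complex_norm)
qed

lemma inner_symplectic_bound: "(x \<bullet> y)\<^sup>2 + (symplectic x y)\<^sup>2 \<le> (norm x)\<^sup>2 * (norm y)\<^sup>2"
proof -
  define w :: "real ^ ('a + 'a)"
    where "w = (\<chi> k. case k of Inl i \<Rightarrow> - x $ Inr i | Inr i \<Rightarrow> x $ Inl i)"
  have UNIV_split: "sum f (UNIV :: ('a + 'a) set)
      = (\<Sum>i\<in>UNIV. f (Inl i)) + (\<Sum>i\<in>UNIV. f (Inr i))" for f :: "_ \<Rightarrow> real"
    by (simp add: UNIV_Plus_UNIV[symmetric] sum.Plus del: UNIV_Plus_UNIV)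
  have wy: "w \<bullet> y = symplectic x y"
    by (simp add: inner_vec_def UNIV_split w_def symplectic_def sum_subtractf sum_negf)
  have xw: "x \<bullet> w = 0"
    by (simp add: inner_vec_def UNIV_split w_def sum_negf mult.commute)
  have ww: "w \<bullet> w = x \<bullet> x"
    by (simp add: inner_vec_def UNIV_split w_def)
  define S where "S = (x \<bullet> y)\<^sup>2 + (symplectic x y)\<^sup>2"
  define v where "v = (x \<bullet> y) *\<^sub>R x + (w \<bullet> y) *\<^sub>R w"
  have yv: "y \<bullet> v = S"
    by (simp add: v_def S_def inner_add_right wy[symmetric] power2_eq_square inner_commute)
  have vv: "v \<bullet> v = S * (x \<bullet> x)"
    using xw by (simp add: v_def S_def wy[symmetric] inner_add_left inner_add_right ww
        inner_commute[of w x] power2_eq_square algebra_simps)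
  have "S\<^sup>2 \<le> (y \<bullet> y) * (S * (x \<bullet> x))"
    using Cauchy_Schwarz_ineq[of y v] by (simp add: yv vv)
  then have "S * S \<le> S * ((x \<bullet> x) * (y \<bullet> y))"
    by (simp add: power2_eq_square mult_ac)
  moreover have "S \<ge> 0"
    by (simp add: S_def)
  ultimately have "S \<le> (x \<bullet> x) * (y \<bullet> y)"
    by (cases "S = 0") auto
  then show ?thesis
    by (simp add: S_def power2_norm_eq_inner)
qed

lemma koranyi_triangle: "koranyi (x + y) \<le> koranyi x + koranyi y"
proof -
  define c where "c z = Complex ((norm (horiz z))\<^sup>2) (vert z)" for z :: "'a heisenberg"
  define p where "p = horiz x \<bullet> horiz y"
  define s where "s = symplectic (horiz x) (horiz y)"
  have le: "norm (horiz z) \<le> koranyi z" for z :: "'a heisenberg"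
    unfolding koranyi_cmod by (intro real_le_rsqrt) (metis complex_Re_le_cmod complex.sel(1))
  have "norm (Complex (2 * p) (s / 2)) \<le> 2 * (norm (horiz x) * norm (horiz y))"
  proof -
    have "(2 * p)\<^sup>2 + (s / 2)\<^sup>2 \<le> 4 * (p\<^sup>2 + s\<^sup>2)"
      by (simp add: power_mult_distrib power_divide)
    also have "\<dots> \<le> (2 * (norm (horiz x) * norm (horiz y)))\<^sup>2"
      using inner_symplectic_bound[of "horiz x" "horiz y"] by (simp add: p_def s_def power_mult_distrib)
    finally show ?thesis
      by (simp add: complex_norm real_le_lsqrt)
  qed
  also have "\<dots> \<le> 2 * (koranyi x * koranyi y)"
    by (intro mult_left_mono mult_mono le) (simp_all add: koranyi_def)
  finally have cross: "norm (Complex (2 * p) (s / 2)) \<le> 2 * (koranyi x * koranyi y)" .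
  have sq: "(koranyi z)\<^sup>2 = norm (c z)" for z :: "'a heisenberg"
    by (simp add: koranyi_cmod c_def)
  have "c (x + y) = c x + c y + Complex (2 * p) (s / 2)"
    by (simp add: c_def p_def s_def plus_heisenberg_def complex_eq_iff power2_norm_eq_inner
        inner_add_left inner_add_right inner_commute)
  then have "(koranyi (x + y))\<^sup>2 \<le> norm (c x) + norm (c y) + norm (Complex (2 * p) (s / 2))"
    unfolding sq by (simp only:) (intro norm_triangle_le add_right_mono norm_triangle_ineq)
  also have "\<dots> \<le> (koranyi x + koranyi y)\<^sup>2"
    using cross by (simp add: sq[symmetric] power2_sum)
  finally show ?thesis
    by (rule power2_le_imp_le) (simp add: koranyi_def)
qed

instantiation heisenberg :: (finite) metric_space
begin

definition dist_heisenberg :: "'a heisenberg \<Rightarrow> 'a heisenberg \<Rightarrow> real"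
  where "dist x y = koranyi (- y + x)"

definition uniformity_heisenberg_def:
  "uniformity = (INF e\<in>{0<..}. principal {(x, y :: 'a heisenberg). dist x y < e})"

definition open_heisenberg_def:
  "open (U :: 'a heisenberg set) \<longleftrightarrow> (\<forall>x\<in>U. eventually (\<lambda>(x', y). x' = x \<longrightarrow> y \<in> U) uniformity)"

instance
proof
  fix x y z :: "'a heisenberg"
  show "dist x y = 0 \<longleftrightarrow> x = y"
    using neg_eq_iff_add_eq_0[of "- y" x] by (auto simp: dist_heisenberg_def koranyi_eq_0_iff)
  have "dist x y = koranyi ((- y + z) + (- z + x))"
    by (simp add: dist_heisenberg_def add.assoc)
  also have "\<dots> \<le> koranyi (- y + z) + koranyi (- z + x)"
    by (rule koranyi_triangle)
  also have "koranyi (- y + z) = koranyi (- z + y)"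
    by (subst koranyi_uminus[symmetric]) (simp add: minus_add)
  finally show "dist x y \<le> dist x z + dist y z"
    by (simp add: dist_heisenberg_def)
qed (simp_all add: uniformity_heisenberg_def open_heisenberg_def)

end

definition lebesgue_heisenberg :: "'n::finite heisenberg measure"
  where "lebesgue_heisenberg = distr lborel borel Heis"

text \<open>
  The map \<open>Heis\<close> is Borel measurable, so the push-forward above assigns to every Borel set
  the Lebesgue measure of its coordinate image.
\<close>

lemma continuous_on_Heis: "continuous_on UNIV (Heis :: _ \<Rightarrow> 'n::finite heisenberg)"
  unfolding continuous_on_def
proof
  fix a :: "(real ^ ('n + 'n)) \<times> real"
  have dist_Heis: "dist (Heis u) (Heis a)
      = root 4 (norm (fst u - fst a) ^ 4 + (snd u - snd a - 1 / 2 * symplectic (fst a) (fst u))\<^sup>2)" for u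
    by (cases u; cases a)
      (simp add: dist_heisenberg_def koranyi_def plus_heisenberg_def uminus_heisenberg_def symplectic_simps)
  have "((\<lambda>u. dist (Heis u) (Heis a)) \<longlongrightarrow>
      root 4 (norm (fst a - fst a) ^ 4 + (snd a - snd a - 1 / 2 * symplectic (fst a) (fst a))\<^sup>2)) (at a)"
    unfolding dist_Heis symplectic_def by (intro tendsto_intros)
  then show "(Heis \<longlongrightarrow> Heis a) (at a)"
    by (subst tendsto_dist_iff) (simp add: symplectic_simps)
qed

lemma measurable_Heis: "(Heis :: _ \<Rightarrow> 'n::finite heisenberg) \<in> borel_measurable lborel"
  using borel_measurable_continuous_onI[OF continuous_on_Heis] by simp

section \<open>Dini continuity and mean oscillations\<close>

text \<open>
  A uniformly continuous function on a bounded subset of \<open>\<real>\<^sup>n\<close> or of the Heisenberg group is bounded,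
  so the real-valued supremum below is the true one wherever it is used.
\<close>

definition continuity_modulus :: "'a::metric_space set \<Rightarrow> ('a \<Rightarrow> real) \<Rightarrow> real \<Rightarrow> real"
  where "continuity_modulus \<Omega> g r =
    (if r = 0 then 0 else Sup {\<bar>g x - g y\<bar> | x y. x \<in> \<Omega> \<and> y \<in> \<Omega> \<and> dist x y \<le> r})"

text \<open>
  On \<open>(0, 1)\<close> the integrand is nonnegative. For \<open>\<rho> \<ge> 1\<close>, where the logarithm is nonpositive,
  it is bounded if \<open>g\<close> is; so on bounded domains finiteness of the integral is integrability.
\<close>

definition log_Dini_continuous :: "nat \<Rightarrow> 'a::metric_space set \<Rightarrow> ('a \<Rightarrow> real) \<Rightarrow> bool"
  where "log_Dini_continuous \<beta> \<Omega> g \<longleftrightarrow>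
    uniformly_continuous_on \<Omega> g \<and>
    set_integrable lborel {0<..<diameter \<Omega> / 2}
      (\<lambda>\<rho>. continuity_modulus \<Omega> g \<rho> * ln (1 / \<rho>) ^ \<beta> / \<rho>)"

definition mean_on :: "'a measure \<Rightarrow> 'a set \<Rightarrow> ('a \<Rightarrow> real) \<Rightarrow> real"
  where "mean_on M B h = (1 / measure M B) * (LINT y:B|M. h y)"

text \<open>
  The series is summed in \<open>[0, \<infinity>]\<close>. The coercion \<open>ennreal\<close> truncates negative
  reals to \<open>0\<close>, which does not occur for \<open>0 < \<tau> < 1\<close> and \<open>0 < r < 1\<close>.
  The means are Bochner integrals, hence meaningful when \<open>g\<close> is bounded and measurable on the balls.
\<close>

definition mean_osc_series ::
  "'a::metric_space measure \<Rightarrow> ('a \<Rightarrow> real) \<Rightarrow> real \<Rightarrow> real \<Rightarrow> nat \<Rightarrow> 'a \<Rightarrow> real \<Rightarrow> ennreal"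
  where "mean_osc_series M g q \<tau> \<beta> x0 r =
    (\<Sum>j. let B = ball x0 (\<tau> ^ j * r) in
      ennreal (ln (1 / (\<tau> ^ j * r)) ^ \<beta> *
        mean_on M B (\<lambda>y. \<bar>g y - mean_on M B g\<bar> powr q) powr (1 / q)))"

definition vanishes_locally_uniformly ::
  "'a::topological_space set \<Rightarrow> ('a \<Rightarrow> real \<Rightarrow> ennreal) \<Rightarrow> bool"
  where "vanishes_locally_uniformly \<Omega> F \<longleftrightarrow>
    (\<forall>x\<in>\<Omega>. \<exists>U. open U \<and> x \<in> U \<and> U \<subseteq> \<Omega> \<and>
      (\<forall>\<epsilon>>0. eventually (\<lambda>r. \<forall>y\<in>U. F y r < ennreal \<epsilon>) (at_right 0)))"

end

theory Submission
  imports Defs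
begin

text \<open>
  The argument is purely metric: it works in any metric space with any measure on its Borel sets,
  and the Euclidean and the Heisenberg part of the theorem are two instances of it.

  Write \<open>\<omega>\<close> for the modulus of continuity and \<open>r\<^sub>j = \<tau>\<^sup>j r\<close>. Two points of \<open>B\<^bsub>r\<^sub>j\<^esub>(x\<^sub>0)\<close> have
  distance at most \<open>2 r\<^sub>j\<close>, so \<open>g\<close> deviates from its mean over that ball by at most \<open>\<omega>(2 r\<^sub>j)\<close>,
  and so does every \<open>L\<^sup>q\<close> mean of the deviation (\<open>mean_oscillation_le\<close>). On the
  interval \<open>(2 r\<^sub>j, 4 r\<^sub>j)\<close> the modulus is at least \<open>\<omega>(2 r\<^sub>j)\<close> by monotonicity, and for
  small \<open>r\<close> the logarithm is at least half of \<open>log(1/r\<^sub>j)\<close>; so the Dini integrand is at least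
  \<open>\<omega>(2 r\<^sub>j) log\<^sup>\<beta>(1/r\<^sub>j) / (2\<^sup>\<beta> 4 r\<^sub>j)\<close> there, on a length of
  \<open>2 r\<^sub>j\<close>. Hence the \<open>j\<close>-th term of the series is at most \<open>2 \<cdot> 2\<^sup>\<beta>\<close> times the Dini integral
  over this interval (\<open>log_modulus_le_Dini_measure\<close>). Since \<open>\<tau> \<le> 1/2\<close>, these intervals are
  disjoint and contained in \<open>(0, 4 r)\<close>, and the series is bounded by \<open>2 \<cdot> 2\<^sup>\<beta>\<close> times the Dini
  integral over \<open>(0, 4 r)\<close> (\<open>mean_osc_series_le_Dini_measure\<close>). That bound does not depend on
  \<open>x\<^sub>0\<close> and tends to \<open>0\<close> with \<open>r\<close>, which gives the uniform convergence.

  For a larger radius \<open>r\<close>, the terms from the \<open>N\<close>-th on form the series with radius \<open>\<tau>\<^sup>N r\<close>, which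
  is covered by the bound above once \<open>N\<close> is large, and the finitely many remaining terms are real
  numbers.
\<close>

section \<open>Means and mean oscillations\<close>

text \<open>
  Positivity of the measure of \<open>B\<close> entails that \<open>B\<close> also has finite measure, because \<open>measure\<close>
  assigns \<open>0\<close> to sets of infinite measure.
\<close>

lemma mean_on_bounds:
  fixes h :: "'a \<Rightarrow> real"
  assumes B: "B \<in> sets M" "0 < measure M B"
    and h: "set_borel_measurable M B h" "\<And>y. y \<in> B \<Longrightarrow> a \<le> h y" "\<And>y. y \<in> B \<Longrightarrow> h y \<le> b"
  shows "a \<le> mean_on M B h" "mean_on M B h \<le> b"
proof -
  have fin: "emeasure M B < \<infinity>"
    using B(2) by (metis infinity_ennreal_def less_irrefl measure_eq_emeasure_eq_ennreal
        measure_zero_top top.not_eq_extremum)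
  have const: "set_integrable M B (\<lambda>_. c)" for c :: real
    using B(1) fin by (simp add: set_integrable_def)
  have const_int: "(LINT y:B|M. c) = c * measure M B" for c :: real
    using B(1) fin by (simp add: set_lebesgue_integral_def)
  have "set_integrable M B h"
  proof (rule set_integrable_bound[OF const[of "max \<bar>a\<bar> \<bar>b\<bar>"] h(1)], rule AE_I2, rule impI)
    fix y assume "y \<in> B"
    then show "norm (h y) \<le> norm (max \<bar>a\<bar> \<bar>b\<bar>)"
      using h(2)[of y] h(3)[of y] by auto
  qed
  then have "(LINT y:B|M. a) \<le> (LINT y:B|M. h y)" "(LINT y:B|M. h y) \<le> (LINT y:B|M. b)"
    using h const by (auto intro!: set_integral_mono)
  then show "a \<le> mean_on M B h" "mean_on M B h \<le> b"
    using B(2) by (simp_all add: const_int mean_on_def field_simps)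
qed

text \<open>
  When \<open>B\<close> has measure \<open>0\<close> or \<open>\<infinity>\<close>, the means are \<open>0\<close> by the conventions for division
  and for \<open>measure\<close>, and the bound is trivial.
\<close>

lemma mean_oscillation_le:
  fixes g :: "'a \<Rightarrow> real"
  assumes B: "B \<in> sets M" and g: "set_borel_measurable M B g" and q: "0 < q" and W: "0 \<le> W"
    and osc: "\<And>y z. y \<in> B \<Longrightarrow> z \<in> B \<Longrightarrow> \<bar>g y - g z\<bar> \<le> W"
  shows "mean_on M B (\<lambda>y. \<bar>g y - mean_on M B g\<bar> powr q) powr (1 / q) \<le> W"
proof (cases "0 < measure M B")
  case False
  then have "measure M B = 0"
    using measure_nonneg[of M B] by linarith
  then show ?thesis
    using W by (simp add: mean_on_def)
next
  case True
  define m where "m = mean_on M B g"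
  have dev: "\<bar>g y - m\<bar> \<le> W" if "y \<in> B" for y
  proof -
    have "g y - W \<le> g z" "g z \<le> g y + W" if "z \<in> B" for z
      using osc[OF \<open>y \<in> B\<close> that] by linarith+
    then have "g y - W \<le> m" "m \<le> g y + W"
      unfolding m_def by (blast intro: mean_on_bounds[OF B True g])+
    then show ?thesis
      by linarith
  qed
  have meas: "set_borel_measurable M B (\<lambda>y. \<bar>g y - m\<bar> powr q)"
  proof -
    have [measurable]: "(\<lambda>y. indicator B y *\<^sub>R g y) \<in> borel_measurable M"
      using g by (simp add: set_borel_measurable_def)
    have [measurable]: "B \<in> sets M"
      by (fact B)
    have "(\<lambda>y. indicator B y *\<^sub>R (\<bar>g y - m\<bar> powr q))
        = (\<lambda>y. indicator B y *\<^sub>R (\<bar>(indicator B y *\<^sub>R g y) - m\<bar> powr q))"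
      by (auto simp: indicator_def)
    also have "\<dots> \<in> borel_measurable M"
      by measurable
    finally show ?thesis
      by (simp add: set_borel_measurable_def)
  qed
  have "0 \<le> mean_on M B (\<lambda>y. \<bar>g y - m\<bar> powr q)"
    "mean_on M B (\<lambda>y. \<bar>g y - m\<bar> powr q) \<le> W powr q"
    using dev q by (auto intro!: mean_on_bounds[OF B True meas, of 0 "W powr q"] powr_mono2)
  then have "mean_on M B (\<lambda>y. \<bar>g y - m\<bar> powr q) powr (1 / q) \<le> (W powr q) powr (1 / q)"
    using q by (intro powr_mono2) auto
  also have "\<dots> = W"
    using q W by (simp add: powr_powr)
  finally show ?thesis
    by (simp add: m_def)
qed

section \<open>The modulus of continuity\<close>

text \<open>
  Uniform continuity bounds \<open>\<bar>g x - g y\<bar>\<close> by \<open>1\<close> for points at distance less than some \<open>\<delta>\<close>.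
  Below that scale the set in \<open>continuity_modulus\<close> is bounded, so its supremum is a true one.
\<close>

lemma continuity_modulus_upper:
  fixes g :: "'a::metric_space \<Rightarrow> real"
  assumes \<delta>: "\<forall>x\<in>\<Omega>. \<forall>y\<in>\<Omega>. dist x y < \<delta> \<longrightarrow> \<bar>g x - g y\<bar> \<le> 1"
    and "0 < r" "r < \<delta>" "x \<in> \<Omega>" "y \<in> \<Omega>" "dist x y \<le> r"
  shows "\<bar>g x - g y\<bar> \<le> continuity_modulus \<Omega> g r"
proof -
  have "bdd_above {\<bar>g x - g y\<bar> |x y. x \<in> \<Omega> \<and> y \<in> \<Omega> \<and> dist x y \<le> r}"
    using \<delta> \<open>r < \<delta>\<close> by (intro bdd_aboveI[of _ 1]) force
  then have "\<bar>g x - g y\<bar> \<le> Sup {\<bar>g x - g y\<bar> |x y. x \<in> \<Omega> \<and> y \<in> \<Omega> \<and> dist x y \<le> r}"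
    using assms by (intro cSup_upper) auto
  then show ?thesis
    using \<open>0 < r\<close> by (simp add: continuity_modulus_def)
qed

lemma continuity_modulus_mono:
  fixes g :: "'a::metric_space \<Rightarrow> real"
  assumes \<delta>: "\<forall>x\<in>\<Omega>. \<forall>y\<in>\<Omega>. dist x y < \<delta> \<longrightarrow> \<bar>g x - g y\<bar> \<le> 1"
    and r: "0 < r" "r \<le> s" "s < \<delta>" and "x \<in> \<Omega>"
  shows "continuity_modulus \<Omega> g r \<le> continuity_modulus \<Omega> g s"
proof -
  have "\<bar>g x - g x\<bar> \<in> {\<bar>g x - g y\<bar> |x y. x \<in> \<Omega> \<and> y \<in> \<Omega> \<and> dist x y \<le> r}"
    using r \<open>x \<in> \<Omega>\<close> by fastforce
  moreover have "c \<le> continuity_modulus \<Omega> g s"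
    if "c \<in> {\<bar>g x - g y\<bar> |x y. x \<in> \<Omega> \<and> y \<in> \<Omega> \<and> dist x y \<le> r}" for c
    using that r by (auto intro!: continuity_modulus_upper[OF \<delta>])
  ultimately have "Sup {\<bar>g x - g y\<bar> |x y. x \<in> \<Omega> \<and> y \<in> \<Omega> \<and> dist x y \<le> r}
      \<le> continuity_modulus \<Omega> g s"
    by (intro cSup_least) auto
  then show ?thesis
    using r by (simp add: continuity_modulus_def)
qed

section \<open>The Dini integral as a measure\<close>

text \<open>
  Viewing the Dini integral as a measure in its domain of integration turns the summation over
  disjoint intervals into countable additivity and its decay at \<open>0\<close> into continuity from above.
  Negative values of the integrand are truncated to \<open>0\<close>; there are none near \<open>\<rho> = 0\<close>, where
  the measure is used.
\<close>

definition Dini_measure ::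
  "nat \<Rightarrow> 'a::metric_space set \<Rightarrow> ('a \<Rightarrow> real) \<Rightarrow> real \<Rightarrow> real measure"
  where "Dini_measure \<beta> \<Omega> g R = density lborel
    (\<lambda>\<rho>. ennreal (indicator {0<..<R} \<rho> *\<^sub>R (continuity_modulus \<Omega> g \<rho> * ln (1 / \<rho>) ^ \<beta> / \<rho>)))"

lemma sets_Dini_measure [simp]: "sets (Dini_measure \<beta> \<Omega> g R) = sets borel"
  by (simp add: Dini_measure_def)

text \<open>
  The Dini condition concerns radii below half the diameter of \<open>\<Omega>\<close>. If the diameter is \<open>0\<close>, this
  says nothing, but then \<open>\<Omega>\<close> is a single point and the modulus of continuity vanishes.
\<close>

lemma log_Dini_continuous_integrable:
  assumes "log_Dini_continuous \<beta> \<Omega> g" "bounded \<Omega>" "x0 \<in> \<Omega>"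
  obtains R where "0 < R"
    "set_integrable lborel {0<..<R} (\<lambda>\<rho>. continuity_modulus \<Omega> g \<rho> * ln (1 / \<rho>) ^ \<beta> / \<rho>)"
proof (cases "0 < diameter \<Omega>")
  case True
  then show ?thesis
    using assms(1) that[of "diameter \<Omega> / 2"] by (simp add: log_Dini_continuous_def)
next
  case False
  then have "x = x0" if "x \<in> \<Omega>" for x
    using diameter_bounded_bound[OF assms(2) that assms(3)]
    by (metis dist_le_zero_iff linorder_not_less order_trans)
  then have single: "\<Omega> = {x0}"
    using assms(3) by blast
  have "continuity_modulus \<Omega> g \<rho> = 0" if "0 < \<rho>" for \<rho>
  proof -
    have "{\<bar>g x - g y\<bar> |x y. x \<in> \<Omega> \<and> y \<in> \<Omega> \<and> dist x y \<le> \<rho>} = {0}"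
      using that by (auto simp: single)
    then show ?thesis
      by (simp add: continuity_modulus_def)
  qed
  then have "(\<lambda>\<rho>. indicator {0<..<1} \<rho> *\<^sub>R (continuity_modulus \<Omega> g \<rho> * ln (1 / \<rho>) ^ \<beta> / \<rho>))
      = (\<lambda>_. 0)"
    by (auto simp: fun_eq_iff indicator_def)
  then show ?thesis
    by (intro that[of 1]) (simp_all add: set_integrable_def)
qed

lemma tendsto_emeasure_shrinking_interval:
  fixes N :: "real measure"
  assumes "sets N = sets borel" "emeasure N UNIV < \<infinity>"
  shows "(\<lambda>n. emeasure N {0<..<1 / real (Suc n)}) \<longlonglongrightarrow> 0"
proof -
  have fin: "emeasure N A \<noteq> \<infinity>" for A
  proof -
    have "emeasure N A \<le> emeasure N UNIV"
      using assms(1) by (intro emeasure_mono) auto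
    then show ?thesis
      using assms(2) by auto
  qed
  have "(\<Inter>n. {0<..<1 / real (Suc n)}) = {}"
  proof (rule ccontr)
    assume "(\<Inter>n. {0<..<1 / real (Suc n)}) \<noteq> {}"
    then obtain x where "x \<in> (\<Inter>n. {0<..<1 / real (Suc n)})"
      by blast
    then have x: "0 < x \<and> x < 1 / real (Suc n)" for n
      unfolding INT_iff greaterThanLessThan_iff by blast
    obtain n where "inverse (real (Suc n)) < x"
      using x reals_Archimedean by blast
    then show False
      using x[of n] by (simp add: inverse_eq_divide)
  qed
  moreover have "decseq (\<lambda>n. {0<..<1 / real (Suc n)})"
  proof (rule decseq_SucI)
    fix n
    have "1 / real (Suc (Suc n)) \<le> 1 / real (Suc n)"
      by (intro divide_left_mono) auto
    then show "{0<..<1 / real (Suc (Suc n))} \<le> {0<..<1 / real (Suc n)}"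
      by (auto simp del: of_nat_Suc)
  qed
  moreover have "range (\<lambda>n. {0<..<1 / real (Suc n)}) \<subseteq> sets N"
    unfolding assms(1) by (intro image_subsetI borel_open open_greaterThanLessThan)
  ultimately show ?thesis
    using Lim_emeasure_decseq[of "\<lambda>n. {0<..<1 / real (Suc n)}" N] fin
    by (simp only: emeasure_empty not_False_eq_True simp_thms)
qed

text \<open>
  For \<open>s \<le> 1/16\<close> one has \<open>log(1/(4 s)) \<ge> log(1/s) / 2\<close>, because \<open>(4 s)\<^sup>2 \<le> s\<close>.
\<close>

lemma log_modulus_le_Dini_measure:
  fixes g :: "'a::metric_space \<Rightarrow> real"
  assumes int: "set_integrable lborel {0<..<R}
      (\<lambda>\<rho>. continuity_modulus \<Omega> g \<rho> * ln (1 / \<rho>) ^ \<beta> / \<rho>)"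
    and \<delta>: "\<forall>x\<in>\<Omega>. \<forall>y\<in>\<Omega>. dist x y < \<delta> \<longrightarrow> \<bar>g x - g y\<bar> \<le> 1"
    and s: "0 < s" "s \<le> 1 / 16" "4 * s \<le> \<delta>" "4 * s \<le> R" and x0: "x0 \<in> \<Omega>"
  shows "ennreal (ln (1 / s) ^ \<beta> * continuity_modulus \<Omega> g (2 * s))
    \<le> ennreal (2 * 2 ^ \<beta>) * emeasure (Dini_measure \<beta> \<Omega> g R) {2 * s<..<4 * s}"
proof -
  let ?\<omega> = "continuity_modulus \<Omega> g"
  let ?F = "\<lambda>\<rho>. indicator {0<..<R} \<rho> *\<^sub>R (?\<omega> \<rho> * ln (1 / \<rho>) ^ \<beta> / \<rho>)"
  define c where "c = ?\<omega> (2 * s) * (ln (1 / s) / 2) ^ \<beta> / (4 * s)"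
  have \<omega>_nonneg: "0 \<le> ?\<omega> (2 * s)"
    using continuity_modulus_upper[OF \<delta>, of "2 * s" x0 x0] s x0 by simp
  have ln_nonneg: "0 \<le> ln (1 / s)"
    using s by (intro ln_ge_zero) (simp add: field_simps)
  have F: "?F \<in> borel_measurable lborel"
    using int by (simp add: set_integrable_def)
  have lower: "c \<le> ?F \<rho>" if \<rho>: "\<rho> \<in> {2 * s<..<4 * s}" for \<rho>
  proof -
    have "\<rho> * \<rho> \<le> (4 * s) * (4 * s)"
      using \<rho> s by (intro mult_mono) auto
    also have "\<dots> \<le> s"
      using s mult_right_mono[of s "1 / 16" s] by simp
    finally have "ln (1 / s) \<le> ln ((1 / \<rho>) * (1 / \<rho>))"
      using \<rho> s by (intro ln_mono) (auto simp: field_simps)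
    then have "ln (1 / s) / 2 \<le> ln (1 / \<rho>)"
      using \<rho> s by (subst (asm) ln_mult) auto
    then have "(ln (1 / s) / 2) ^ \<beta> \<le> ln (1 / \<rho>) ^ \<beta>"
      using ln_nonneg by (intro power_mono) auto
    moreover have "?\<omega> (2 * s) \<le> ?\<omega> \<rho>"
      using \<rho> s x0 by (intro continuity_modulus_mono[OF \<delta>]) auto
    ultimately have "c \<le> ?\<omega> \<rho> * ln (1 / \<rho>) ^ \<beta> / \<rho>"
      unfolding c_def using \<omega>_nonneg ln_nonneg \<rho> s
      by (intro frac_le mult_mono mult_nonneg_nonneg) (auto intro: order_trans)
    then show ?thesis
      using \<rho> s by simp
  qed
  have "c * (2 * s) = ln (1 / s) ^ \<beta> * ?\<omega> (2 * s) / (2 * 2 ^ \<beta>)"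
    using s by (simp add: c_def power_divide field_simps)
  then have "ln (1 / s) ^ \<beta> * ?\<omega> (2 * s) = (2 * 2 ^ \<beta>) * (c * (2 * s))"
    by simp
  then have eq: "ennreal (ln (1 / s) ^ \<beta> * ?\<omega> (2 * s))
      = ennreal (2 * 2 ^ \<beta>) * ennreal (c * (2 * s))"
    using ennreal_mult'[of "2 * 2 ^ \<beta>" "c * (2 * s)"] by simp
  have "ennreal (c * (2 * s)) = (\<integral>\<^sup>+ \<rho>. ennreal c * indicator {2 * s<..<4 * s} \<rho> \<partial>lborel)"
    using s by (simp add: nn_integral_cmult_indicator ennreal_mult'')
  also have "\<dots> \<le> (\<integral>\<^sup>+ \<rho>. ennreal (?F \<rho>) * indicator {2 * s<..<4 * s} \<rho> \<partial>lborel)"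
  proof (rule nn_integral_mono)
    fix \<rho>
    show "ennreal c * indicator {2 * s<..<4 * s} \<rho>
        \<le> ennreal (?F \<rho>) * indicator {2 * s<..<4 * s} \<rho>"
    proof (cases "\<rho> \<in> {2 * s<..<4 * s}")
      case True
      then show ?thesis
        by (intro mult_right_mono ennreal_leI lower) simp_all
    qed (simp only: indicator_simps mult_zero_right order_refl not_False_eq_True)
  qed
  also have "\<dots> = emeasure (Dini_measure \<beta> \<Omega> g R) {2 * s<..<4 * s}"
  proof -
    have "(\<lambda>\<rho>. ennreal (?F \<rho>)) \<in> borel_measurable lborel"
      by (rule measurable_compose[OF F measurable_ennreal])
    moreover have "{2 * s<..<4 * s} \<in> sets lborel"
      by simp
    ultimately show ?thesis
      unfolding Dini_measure_def by (rule emeasure_density[symmetric])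
  qed
  finally have "ennreal (c * (2 * s)) \<le> emeasure (Dini_measure \<beta> \<Omega> g R) {2 * s<..<4 * s}" .
  then show ?thesis
    unfolding eq by (rule mult_left_mono) simp
qed

section \<open>The series of mean oscillations\<close>

lemma mean_osc_series_le_Dini_measure:
  fixes g :: "'a::metric_space \<Rightarrow> real"
  assumes M: "sets M = sets borel" and cont: "continuous_on \<Omega> g"
    and int: "set_integrable lborel {0<..<R}
      (\<lambda>\<rho>. continuity_modulus \<Omega> g \<rho> * ln (1 / \<rho>) ^ \<beta> / \<rho>)"
    and \<delta>: "\<forall>x\<in>\<Omega>. \<forall>y\<in>\<Omega>. dist x y < \<delta> \<longrightarrow> \<bar>g x - g y\<bar> \<le> 1"
    and q: "0 < q" and \<tau>: "0 < \<tau>" "\<tau> \<le> 1 / 2"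
    and r: "0 < r" "r \<le> 1 / 16" "4 * r \<le> \<delta>" "4 * r \<le> R" and B: "ball x0 r \<subseteq> \<Omega>"
  shows "mean_osc_series M g q \<tau> \<beta> x0 r
    \<le> ennreal (2 * 2 ^ \<beta>) * emeasure (Dini_measure \<beta> \<Omega> g R) {0<..<4 * r}"
proof -
  define s where "s j = \<tau> ^ j * r" for j
  define I where "I j = {2 * s j<..<4 * s j}" for j
  let ?N = "Dini_measure \<beta> \<Omega> g R"
  have s_pos: "0 < s j" for j
    using \<tau> r by (simp add: s_def)
  have s_le: "s j \<le> r" for j
    using \<tau> r by (simp add: s_def power_le_one mult_left_le_one_le)
  have x0: "x0 \<in> \<Omega>"
    using B r by auto
  have "mean_osc_series M g q \<tau> \<beta> x0 r \<le> (\<Sum>j. ennreal (2 * 2 ^ \<beta>) * emeasure ?N (I j))"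
    unfolding mean_osc_series_def Let_def s_def[symmetric]
  proof (intro suminf_le summableI)
    fix j
    let ?B = "ball x0 (s j)"
    have sub: "?B \<subseteq> \<Omega>"
      using B s_le[of j] by auto
    have upper: "\<bar>g y - g z\<bar> \<le> continuity_modulus \<Omega> g (2 * s j)" if "y \<in> ?B" "z \<in> ?B" for y z
    proof (rule continuity_modulus_upper[OF \<delta>])
      show "dist y z \<le> 2 * s j"
        using that dist_triangle2[of y z x0] by (simp add: dist_commute)
    qed (use that sub s_pos[of j] s_le[of j] r in auto)
    have "mean_on M ?B (\<lambda>y. \<bar>g y - mean_on M ?B g\<bar> powr q) powr (1 / q)
        \<le> continuity_modulus \<Omega> g (2 * s j)"
    proof (rule mean_oscillation_le)
      show "set_borel_measurable M ?B g"
        unfolding set_borel_measurable_def measurable_cong_sets[OF M refl]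
        by (intro borel_measurable_continuous_on_indicator continuous_on_subset[OF cont sub]) simp
      show "0 \<le> continuity_modulus \<Omega> g (2 * s j)"
        using upper[of x0 x0] s_pos by simp
    qed (use M q upper in auto)
    moreover have "0 \<le> ln (1 / s j)"
      using s_pos[of j] s_le[of j] r by (intro ln_ge_zero) (simp add: field_simps)
    ultimately have "ennreal (ln (1 / s j) ^ \<beta> *
          mean_on M ?B (\<lambda>y. \<bar>g y - mean_on M ?B g\<bar> powr q) powr (1 / q))
        \<le> ennreal (ln (1 / s j) ^ \<beta> * continuity_modulus \<Omega> g (2 * s j))"
      by (intro ennreal_leI mult_left_mono) auto
    also have "\<dots> \<le> ennreal (2 * 2 ^ \<beta>) * emeasure ?N (I j)"
      unfolding I_def using s_pos[of j] s_le[of j] r x0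
      by (intro log_modulus_le_Dini_measure[OF int \<delta>]) auto
    finally show "ennreal (ln (1 / s j) ^ \<beta> *
          mean_on M ?B (\<lambda>y. \<bar>g y - mean_on M ?B g\<bar> powr q) powr (1 / q))
        \<le> ennreal (2 * 2 ^ \<beta>) * emeasure ?N (I j)" .
  qed
  also have "\<dots> = ennreal (2 * 2 ^ \<beta>) * (\<Sum>j. emeasure ?N (I j))"
    by (rule ennreal_suminf_cmult)
  also have "(\<Sum>j. emeasure ?N (I j)) = emeasure ?N (\<Union>j. I j)"
  proof (rule suminf_emeasure)
    have "I i \<inter> I j = {}" if "i < j" for i j
    proof -
      have "\<tau> ^ j \<le> \<tau> ^ Suc i"
        using that \<tau> by (intro power_decreasing) auto
      also have "\<dots> \<le> \<tau> ^ i / 2"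
        using \<tau> mult_right_mono[of \<tau> "1 / 2" "\<tau> ^ i"] by simp
      finally have "\<tau> ^ j * r \<le> \<tau> ^ i / 2 * r"
        using r by (intro mult_right_mono) auto
      then have "4 * s j \<le> 2 * s i"
        by (simp add: s_def mult_ac)
      then show ?thesis
        by (auto simp: I_def)
    qed
    then show "disjoint_family I"
      unfolding disjoint_family_on_def by (metis inf_commute linorder_neqE_nat)
  qed (auto simp: I_def)
  also have "\<dots> \<le> emeasure ?N {0<..<4 * r}"
  proof (rule emeasure_mono)
    show "(\<Union>j. I j) \<subseteq> {0<..<4 * r}"
    proof
      fix \<rho> assume "\<rho> \<in> (\<Union>j. I j)"
      then obtain j where "2 * s j < \<rho>" "\<rho> < 4 * s j"
        by (auto simp: I_def)
      then show "\<rho> \<in> {0<..<4 * r}"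
        using s_pos[of j] s_le[of j] by auto
    qed
  qed simp
  finally show ?thesis
    by (simp add: mult_left_mono)
qed

lemma mean_osc_series_shift:
  "mean_osc_series M g q \<tau> \<beta> x0 (\<tau> ^ k * r) < \<infinity> \<Longrightarrow> mean_osc_series M g q \<tau> \<beta> x0 r < \<infinity>"
proof -
  define a where "a j = (let B = ball x0 (\<tau> ^ j * r) in
      ennreal (ln (1 / (\<tau> ^ j * r)) ^ \<beta> *
        mean_on M B (\<lambda>y. \<bar>g y - mean_on M B g\<bar> powr q) powr (1 / q)))" for j
  assume "mean_osc_series M g q \<tau> \<beta> x0 (\<tau> ^ k * r) < \<infinity>"
  moreover have "mean_osc_series M g q \<tau> \<beta> x0 (\<tau> ^ k * r) = (\<Sum>j. a (j + k))"
    by (simp add: mean_osc_series_def a_def power_add mult.assoc)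
  moreover have "(\<Sum>j<k. a j) < \<infinity>"
    by (simp add: a_def Let_def)
  moreover have "mean_osc_series M g q \<tau> \<beta> x0 r = (\<Sum>j. a (j + k)) + (\<Sum>j<k. a j)"
    unfolding mean_osc_series_def a_def[symmetric] by (intro suminf_offset summableI)
  ultimately show ?thesis
    by simp
qed

text \<open>
  One threshold \<open>\<eta>\<close> for the radius serves all centres, which yields both finiteness and
  uniformity.
\<close>

lemma log_Dini_continuous_imp_uniformly_small:
  fixes g :: "'a::metric_space \<Rightarrow> real"
  assumes M: "sets M = sets borel" and \<Omega>: "bounded \<Omega>" and g: "log_Dini_continuous \<beta> \<Omega> g"
    and q: "0 < q" and \<tau>: "0 < \<tau>" "\<tau> \<le> 1 / 2" and \<epsilon>: "0 < \<epsilon>"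
  obtains \<eta> where "0 < \<eta>"
    "\<And>x r. 0 < r \<Longrightarrow> r \<le> \<eta> \<Longrightarrow> ball x r \<subseteq> \<Omega> \<Longrightarrow> mean_osc_series M g q \<tau> \<beta> x r < ennreal \<epsilon>"
proof (cases "\<Omega> = {}")
  case True
  then show ?thesis
    by (intro that[of 1]) auto
next
  case False
  then obtain x0 where x0: "x0 \<in> \<Omega>"
    by auto
  have uc: "uniformly_continuous_on \<Omega> g"
    using g by (simp add: log_Dini_continuous_def)
  obtain \<delta> where "0 < \<delta>"
    and \<delta>': "\<And>x y. x \<in> \<Omega> \<Longrightarrow> y \<in> \<Omega> \<Longrightarrow> dist y x < \<delta> \<Longrightarrow> dist (g y) (g x) < 1"
    using uc unfolding uniformly_continuous_on_def by (metis zero_less_one)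
  have \<delta>: "\<forall>x\<in>\<Omega>. \<forall>y\<in>\<Omega>. dist x y < \<delta> \<longrightarrow> \<bar>g x - g y\<bar> \<le> 1"
    using \<delta>' by (fastforce simp: dist_real_def)
  obtain R where "0 < R" and int: "set_integrable lborel {0<..<R}
      (\<lambda>\<rho>. continuity_modulus \<Omega> g \<rho> * ln (1 / \<rho>) ^ \<beta> / \<rho>)"
    using log_Dini_continuous_integrable[OF g \<Omega> x0] by blast
  let ?N = "Dini_measure \<beta> \<Omega> g R"
  have "emeasure ?N UNIV < \<infinity>"
  proof -
    let ?F = "\<lambda>\<rho>. indicator {0<..<R} \<rho> *\<^sub>R
      (continuity_modulus \<Omega> g \<rho> * ln (1 / \<rho>) ^ \<beta> / \<rho>)"
    have F: "integrable lborel ?F"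
      using int by (simp add: set_integrable_def)
    have "emeasure ?N UNIV = (\<integral>\<^sup>+ \<rho>. ennreal (?F \<rho>) \<partial>lborel)"
      unfolding Dini_measure_def using borel_measurable_integrable[OF F]
      by (subst emeasure_density) auto
    also have "\<dots> \<le> (\<integral>\<^sup>+ \<rho>. ennreal (norm (?F \<rho>)) \<partial>lborel)"
      by (intro nn_integral_mono ennreal_leI) (simp only: real_norm_def abs_ge_self)
    also have "\<dots> < \<infinity>"
      using F by (simp add: integrable_iff_bounded)
    finally show ?thesis .
  qed
  then have "(\<lambda>n. ennreal (2 * 2 ^ \<beta>) * emeasure ?N {0<..<1 / real (Suc n)})
      \<longlonglongrightarrow> ennreal (2 * 2 ^ \<beta>) * 0"
    by (intro ennreal_tendsto_cmult tendsto_emeasure_shrinking_interval) auto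
  then have "\<forall>\<^sub>F n in sequentially.
      ennreal (2 * 2 ^ \<beta>) * emeasure ?N {0<..<1 / real (Suc n)} < ennreal \<epsilon>"
    by (rule order_tendstoD) (use \<epsilon> in simp)
  then obtain n where
    n: "ennreal (2 * 2 ^ \<beta>) * emeasure ?N {0<..<1 / real (Suc n)} < ennreal \<epsilon>"
    by (auto simp: eventually_sequentially)
  define \<eta> where "\<eta> = Min {1 / 16, \<delta> / 4, R / 4, 1 / real (Suc n) / 4}"
  show ?thesis
  proof (rule that)
    show "0 < \<eta>"
      using \<open>0 < \<delta>\<close> \<open>0 < R\<close> by (simp add: \<eta>_def)
    fix x r
    assume r: "0 < r" "r \<le> \<eta>" and B: "ball x r \<subseteq> \<Omega>"
    have small: "r \<le> 1 / 16" "4 * r \<le> \<delta>" "4 * r \<le> R" "4 * r \<le> 1 / real (Suc n)"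
      using r(2) unfolding \<eta>_def by (simp_all del: of_nat_Suc divide_divide_eq_left)
    have "mean_osc_series M g q \<tau> \<beta> x r \<le> ennreal (2 * 2 ^ \<beta>) * emeasure ?N {0<..<4 * r}"
      using small r B \<tau> q uniformly_continuous_imp_continuous[OF uc]
      by (intro mean_osc_series_le_Dini_measure[OF M _ int \<delta>]) auto
    also have "\<dots> \<le> ennreal (2 * 2 ^ \<beta>) * emeasure ?N {0<..<1 / real (Suc n)}"
      using small(4) by (intro mult_left_mono emeasure_mono) auto
    also note n
    finally show "mean_osc_series M g q \<tau> \<beta> x r < ennreal \<epsilon>" .
  qed
qed

lemma mean_osc_series_finite:
  fixes g :: "'a::metric_space \<Rightarrow> real"
  assumes "sets M = sets borel" "bounded \<Omega>" "log_Dini_continuous \<beta> \<Omega> g"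
    and "0 < q" and \<tau>: "0 < \<tau>" "\<tau> \<le> 1 / 2" and r: "0 < r" "ball x r \<subseteq> \<Omega>"
  shows "mean_osc_series M g q \<tau> \<beta> x r < \<infinity>"
proof -
  obtain \<eta> where "0 < \<eta>" and \<eta>: "\<And>x r. 0 < r \<Longrightarrow> r \<le> \<eta> \<Longrightarrow> ball x r \<subseteq> \<Omega> \<Longrightarrow>
      mean_osc_series M g q \<tau> \<beta> x r < ennreal 1"
    using log_Dini_continuous_imp_uniformly_small[OF assms(1-6) zero_less_one] by blast
  obtain k where "\<tau> ^ k < \<eta> / r"
    using real_arch_pow_inv[of "\<eta> / r" \<tau>] \<open>0 < \<eta>\<close> r \<tau> by auto
  then have "\<tau> ^ k * r \<le> \<eta>"
    using r by (simp add: field_simps)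
  moreover have "\<tau> ^ k * r \<le> r"
    using \<tau> r by (simp add: power_le_one mult_left_le_one_le)
  then have "ball x (\<tau> ^ k * r) \<subseteq> \<Omega>"
    using r subset_ball by blast
  ultimately have "mean_osc_series M g q \<tau> \<beta> x (\<tau> ^ k * r) < ennreal 1"
    using \<tau> r by (intro \<eta>) auto
  then show ?thesis
    using mean_osc_series_shift ennreal_less_top less_trans infinity_ennreal_def by metis
qed

lemma mean_osc_series_vanishes_locally_uniformly:
  fixes g :: "'a::metric_space \<Rightarrow> real"
  assumes M: "sets M = sets borel" and "open \<Omega>" and bg: "bounded \<Omega>" "log_Dini_continuous \<beta> \<Omega> g"
    and q: "0 < q" and \<tau>: "0 < \<tau>" "\<tau> \<le> 1 / 2"
  shows "vanishes_locally_uniformly \<Omega> (mean_osc_series M g q \<tau> \<beta>)"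
  unfolding vanishes_locally_uniformly_def
proof
  fix x assume "x \<in> \<Omega>"
  then obtain e where "0 < e" and e: "ball x e \<subseteq> \<Omega>"
    using \<open>open \<Omega>\<close> by (meson openE)
  (* A ball of radius at most e/2 centred in ball x (e/2) stays in ball x e. *)
  have "\<forall>\<^sub>F r in at_right 0. \<forall>y\<in>ball x (e / 2). mean_osc_series M g q \<tau> \<beta> y r < ennreal \<epsilon>"
    if "0 < \<epsilon>" for \<epsilon>
  proof -
    obtain \<eta> where "0 < \<eta>" and \<eta>: "\<And>x r. 0 < r \<Longrightarrow> r \<le> \<eta> \<Longrightarrow> ball x r \<subseteq> \<Omega> \<Longrightarrow>
        mean_osc_series M g q \<tau> \<beta> x r < ennreal \<epsilon>"
      using log_Dini_continuous_imp_uniformly_small[OF M bg q \<tau> \<open>0 < \<epsilon>\<close>] by blast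
    have "\<forall>\<^sub>F r in at_right 0. r \<in> {0<..<min \<eta> (e / 2)}"
      using \<open>0 < \<eta>\<close> \<open>0 < e\<close> by (intro eventually_at_right_real) auto
    then show ?thesis
    proof eventually_elim
      case (elim r)
      have "ball y r \<subseteq> \<Omega>" if "y \<in> ball x (e / 2)" for y
      proof -
        have "ball y r \<subseteq> ball x e"
        proof
          fix z assume "z \<in> ball y r"
          then show "z \<in> ball x e"
            using that elim dist_triangle[of x z y] by auto
        qed
        then show ?thesis
          using e by blast
      qed
      then show ?case
        using elim \<eta> by auto
    qed
  qed
  moreover have "ball x (e / 2) \<subseteq> \<Omega>"
    using e \<open>0 < e\<close> by auto
  ultimately show "\<exists>U. open U \<and> x \<in> U \<and> U \<subseteq> \<Omega> \<and>
      (\<forall>\<epsilon>>0. \<forall>\<^sub>F r in at_right 0. \<forall>y\<in>U. mean_osc_series M g q \<tau> \<beta> y r < ennreal \<epsilon>)"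
    using \<open>0 < e\<close> by (intro exI[of _ "ball x (e / 2)"]) auto
qed

theorem proposition14:
  fixes \<beta> :: nat and q \<tau> :: real
    and \<Omega> :: "(real ^ 'n::finite) set" and g :: "real ^ 'n \<Rightarrow> real"
    and \<Omega>\<^sub>H :: "'m::finite heisenberg set" and g\<^sub>H :: "'m heisenberg \<Rightarrow> real"
  assumes "\<beta> \<in> {0, 1}" and "1 < q" and "0 < \<tau>" and "\<tau> < 1 / 4"
  shows "(open \<Omega> \<and> bounded \<Omega> \<and> log_Dini_continuous \<beta> \<Omega> g \<longrightarrow>
      (\<forall>x0 r. 0 < r \<and> r < 1 / 4 \<and> ball x0 (4 * r) \<subseteq> \<Omega> \<longrightarrow>
        mean_osc_series lborel g q \<tau> \<beta> x0 r < \<infinity>) \<and>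
      vanishes_locally_uniformly \<Omega> (mean_osc_series lborel g q \<tau> \<beta>)) \<and>
    (open \<Omega>\<^sub>H \<and> bounded \<Omega>\<^sub>H \<and> log_Dini_continuous \<beta> \<Omega>\<^sub>H g\<^sub>H \<longrightarrow>
      (\<forall>x0 r. 0 < r \<and> r < 1 / 4 \<and> ball x0 (4 * r) \<subseteq> \<Omega>\<^sub>H \<longrightarrow>
        mean_osc_series lebesgue_heisenberg g\<^sub>H q \<tau> \<beta> x0 r < \<infinity>) \<and>
      vanishes_locally_uniformly \<Omega>\<^sub>H (mean_osc_series lebesgue_heisenberg g\<^sub>H q \<tau> \<beta>))"
proof -
  have q: "0 < q" and \<tau>: "0 < \<tau>" "\<tau> \<le> 1 / 2"
    using assms by auto
  have H: "sets (lebesgue_heisenberg :: 'm heisenberg measure) = sets borel"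
    by (simp add: lebesgue_heisenberg_def)
  have sub: "ball x r \<subseteq> S" if "0 < r" "ball x (4 * r) \<subseteq> S" for x :: "real ^ 'n" and r S
    using that subset_ball[of r "4 * r" x] by auto
  have sub\<^sub>H: "ball x r \<subseteq> S" if "0 < r" "ball x (4 * r) \<subseteq> S" for x :: "'m heisenberg" and r S
    using that subset_ball[of r "4 * r" x] by auto
  show ?thesis
  proof (intro conjI impI allI; elim conjE)
    show "mean_osc_series lborel g q \<tau> \<beta> x0 r < \<infinity>"
      if "bounded \<Omega>" "log_Dini_continuous \<beta> \<Omega> g" "0 < r" "ball x0 (4 * r) \<subseteq> \<Omega>" for x0 r
      by (rule mean_osc_series_finite[OF sets_lborel that(1,2) q \<tau> that(3) sub[OF that(3,4)]])
    show "mean_osc_series lebesgue_heisenberg g\<^sub>H q \<tau> \<beta> x0 r < \<infinity>"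
      if "bounded \<Omega>\<^sub>H" "log_Dini_continuous \<beta> \<Omega>\<^sub>H g\<^sub>H" "0 < r" "ball x0 (4 * r) \<subseteq> \<Omega>\<^sub>H" for x0 r
      by (rule mean_osc_series_finite[OF H that(1,2) q \<tau> that(3) sub\<^sub>H[OF that(3,4)]])
    show "vanishes_locally_uniformly \<Omega> (mean_osc_series lborel g q \<tau> \<beta>)"
      if "open \<Omega>" "bounded \<Omega>" "log_Dini_continuous \<beta> \<Omega> g"
      by (rule mean_osc_series_vanishes_locally_uniformly[OF sets_lborel that q \<tau>])
    show "vanishes_locally_uniformly \<Omega>\<^sub>H (mean_osc_series lebesgue_heisenberg g\<^sub>H q \<tau> \<beta>)"
      if "open \<Omega>\<^sub>H" "bounded \<Omega>\<^sub>H" "log_Dini_continuous \<beta> \<Omega>\<^sub>H g\<^sub>H"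
      by (rule mean_osc_series_vanishes_locally_uniformly[OF H that q \<tau>])
  qed
qed

end
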